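(* The exceptional Lie group $\mathrm{G}_{2(-14)}$ has the realisation $$\mathrm{G}_{2(-14)}\cong\{(A,B,C)\in\mathrm{Spin}(8): B(s*x)=C(s)*A(x)\ \ \forall\, s,x\in\mathcal{O},\ A(e)=B(e)=C(e)=e\},$$ or, equivalently, $$\mathrm{G}_{2(-14)}\cong\{(A,B,C)\in\mathrm{Tri}(\mathcal{O}): B(e*x)=e*A(x),\ B(x*e)=C(x)*e\ \ \forall\, x\in\mathcal{O}\}.$$
   Context: The real Okubo algebra $\mathcal{O}$ is the 8-dimensional real vector space of $3\times 3$ complex Hermitian traceless matrices with bilinear product $x*y=\mu\,xy+\overline{\mu}\,yx-\frac13\mathrm{Tr}(xy)\,I$, where $\mu=\frac16(3+\mathrm{i}\sqrt3)$, and positive definite norm $n(x)=\frac16\mathrm{Tr}(x^2)$. The element $e=\mathrm{diag}(2,-1,-1)$ is an idempotent: $e*e=e$. The triality group $\mathrm{Tri}(\mathcal{O})$ is the group, under componentwise composition, of triples $(A,B,C)$ of linear maps in the special orthogonal group $\mathrm{SO}(\mathcal{O},n)$ such that $B(s*x)=C(s)*A(x)$ for all $s,x\in\mathcal{O}$. It is isomorphic to $\mathrm{Spin}(8)$, and "$(A,B,C)\in\mathrm{Spin}(8)$" refers to this identification of $\mathrm{Spin}(8)$ with triples of linear maps of $\mathcal{O}$. $\mathrm{G}_{2(-14)}$ is the compact real form of the exceptional Lie group $\mathrm{G}_2$, i.e. the automorphism group of the octonions. *)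

theory Defs
  imports "HOL-Analysis.Analysis" "HOL-Algebra.Group"
begin

section \<open>Determinant of a linear endomorphism\<close>

text \<open>Leibniz formula with respect to the orthonormal basis \<open>Basis\<close>; the lemma below identifies it
  with the library determinant of the matrix of \<open>f\<close> in any enumeration of that basis.\<close>

definition lin_det :: "('a::euclidean_space \<Rightarrow> 'a) \<Rightarrow> real" where
  "lin_det f = (\<Sum>p | p permutes Basis. of_int (sign p) * (\<Prod>b\<in>Basis. f b \<bullet> p b))"

lemma lin_det_eq_det:
  fixes f :: "'a::euclidean_space \<Rightarrow> 'a" and b :: "'n::finite \<Rightarrow> 'a"
  assumes b: "bij_betw b UNIV Basis"
  shows "lin_det f = det (\<chi> i j. f (b j) \<bullet> b i)"
proof -
  let ?h = "map_permutation UNIV b"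
  have inj: "inj b" using b by (simp add: bij_betw_def)
  have app: "?h p (b i) = b (p i)" for p i
    using b by (auto simp: map_permutation_def restrict_id_def bij_betw_def)
  have bij: "bij_betw ?h {p. p permutes (UNIV::'n set)} {p. p permutes Basis}"
  proof -
    have "?h = (\<lambda>\<pi> x. if x \<in> Basis then b (\<pi> (inv_into UNIV b x)) else x)"
      using b by (simp add: fun_eq_iff map_permutation_def restrict_id_def bij_betw_def)
    with bij_betw_permutations[OF b] show ?thesis by simp
  qed
  have "lin_det f = (\<Sum>p | p permutes (UNIV::'n set).
          of_int (sign (?h p)) * (\<Prod>c\<in>Basis. f c \<bullet> ?h p c))"
    unfolding lin_det_def by (rule sum.reindex_bij_betw[OF bij, symmetric])
  also have "\<dots> = (\<Sum>p | p permutes (UNIV::'n set).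
          of_int (sign p) * (\<Prod>i\<in>UNIV. f (b i) \<bullet> b (p i)))"
  proof (rule sum.cong[OF refl])
    fix p :: "'n \<Rightarrow> 'n" assume p: "p \<in> {p. p permutes UNIV}"
    have "sign (?h p) = sign p"
      using p by (intro sign_map_permutation) (auto simp: inj)
    moreover have "(\<Prod>c\<in>Basis. f c \<bullet> ?h p c) = (\<Prod>i\<in>UNIV. f (b i) \<bullet> ?h p (b i))"
      by (rule prod.reindex_bij_betw[OF b, symmetric])
    ultimately show "of_int (sign (?h p)) * (\<Prod>c\<in>Basis. f c \<bullet> ?h p c)
        = of_int (sign p) * (\<Prod>i\<in>UNIV. f (b i) \<bullet> b (p i))"
      by (simp add: app)
  qed
  also have "\<dots> = det (transpose (\<chi> i j. f (b j) \<bullet> b i))"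
    by (simp add: det_def transpose_def)
  finally show ?thesis by (simp add: det_transpose)
qed

section \<open>The real Okubo algebra\<close>

definition hermitian3 :: "complex^3^3 \<Rightarrow> bool" where
  "hermitian3 X \<longleftrightarrow> map_matrix cnj (transpose X) = X"

definition cscale :: "complex \<Rightarrow> complex^3^3 \<Rightarrow> complex^3^3" where
  "cscale c X = map_matrix ((*) c) X"

lemma hermitian3_iff: "hermitian3 X \<longleftrightarrow> (\<forall>i j. cnj (X $ j $ i) = X $ i $ j)"
  by (simp add: hermitian3_def vec_eq_iff transpose_def)

lemma trace3: "trace (X::complex^3^3) = X$1$1 + X$2$2 + X$3$3"
  by (simp add: trace_def sum_3)

typedef okubo = "{X :: complex^3^3. hermitian3 X \<and> trace X = 0}"
  by (rule exI[of _ 0]) (simp add: hermitian3_iff trace3)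

setup_lifting type_definition_okubo

definition okubo_mu :: complex where
  "okubo_mu = (3 + \<i> * complex_of_real (sqrt 3)) / 6"

lemma okubo_mu_sum: "okubo_mu + cnj okubo_mu = 1"
  by (simp add: okubo_mu_def complex_eq_iff)

lift_definition okubo_mult :: "okubo \<Rightarrow> okubo \<Rightarrow> okubo" (infixl \<open>\<star>\<close> 70) is
  "\<lambda>x y. cscale okubo_mu (x ** y) + cscale (cnj okubo_mu) (y ** x) - mat (trace (x ** y) / 3)"
proof -
  fix x y :: "complex^3^3"
  assume x: "hermitian3 x \<and> trace x = 0" and y: "hermitian3 y \<and> trace y = 0"
  have hx: "cnj (x $ i $ j) = x $ j $ i" and hy: "cnj (y $ i $ j) = y $ j $ i" for i j
    using x y by (auto simp: hermitian3_iff)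
  have "trace (cscale okubo_mu (x ** y) + cscale (cnj okubo_mu) (y ** x))
      = (okubo_mu + cnj okubo_mu) * trace (x ** y)"
    by (simp add: trace3 cscale_def matrix_matrix_mult_def sum_3 algebra_simps)
  then show "hermitian3 (cscale okubo_mu (x ** y) + cscale (cnj okubo_mu) (y ** x)
      - mat (trace (x ** y) / 3)) \<and>
    trace (cscale okubo_mu (x ** y) + cscale (cnj okubo_mu) (y ** x)
      - mat (trace (x ** y) / 3)) = 0"
    by (auto simp: okubo_mu_sum hermitian3_iff trace3 cscale_def matrix_matrix_mult_def
        sum_3 mat_def hx hy algebra_simps)
qed

lift_definition okubo_norm :: "okubo \<Rightarrow> real" is "\<lambda>x. Re (trace (x ** x)) / 6" .

lift_definition okubo_e :: okubo is
  "vector [vector [2, 0, 0], vector [0, -1, 0], vector [0, 0, -1]]"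
  by (simp add: hermitian3_iff trace3 forall_3)

instantiation okubo :: real_vector
begin

lift_definition zero_okubo :: okubo is 0
  by (simp add: hermitian3_iff trace3)

lift_definition plus_okubo :: "okubo \<Rightarrow> okubo \<Rightarrow> okubo" is "(+)"
  by (auto simp: hermitian3_iff trace_add trace_sub)

lift_definition uminus_okubo :: "okubo \<Rightarrow> okubo" is uminus
  by (auto simp: hermitian3_iff trace_def sum_negf)

lift_definition minus_okubo :: "okubo \<Rightarrow> okubo \<Rightarrow> okubo" is "(-)"
  by (auto simp: hermitian3_iff trace_add trace_sub)

lift_definition scaleR_okubo :: "real \<Rightarrow> okubo \<Rightarrow> okubo" is scaleR
  by (auto simp: hermitian3_iff trace3 simp flip: scaleR_add_right)

instance
  by standard (transfer; simp add: algebra_simps)+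

end

text \<open>The inner product is the one with \<open>x \<bullet> x = n(x)\<close>.\<close>

instantiation okubo :: real_inner
begin

lift_definition inner_okubo :: "okubo \<Rightarrow> okubo \<Rightarrow> real" is "\<lambda>x y. Re (trace (x ** y)) / 6" .

definition norm_okubo :: "okubo \<Rightarrow> real" where "norm_okubo x = sqrt (x \<bullet> x)"
definition sgn_okubo :: "okubo \<Rightarrow> okubo" where "sgn_okubo x = x /\<^sub>R norm x"
definition dist_okubo :: "okubo \<Rightarrow> okubo \<Rightarrow> real" where "dist_okubo x y = norm (x - y)"
definition uniformity_okubo :: "(okubo \<times> okubo) filter" where
  "uniformity_okubo = (INF e\<in>{0<..}. principal {(x, y). dist x y < e})"
definition open_okubo :: "okubo set \<Rightarrow> bool" where
  "open_okubo U \<longleftrightarrow> (\<forall>x\<in>U. eventually (\<lambda>(x', y). x' = x \<longrightarrow> y \<in> U) uniformity)"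

lemma inner_okubo_Rep: "x \<bullet> y = (Rep_okubo x \<bullet> Rep_okubo y) / 6"
proof -
  have "cnj (Rep_okubo y $ i $ j) = Rep_okubo y $ j $ i" for i j
    using Rep_okubo[of y] by (auto simp: hermitian3_iff)
  then have r: "Re (Rep_okubo y $ j $ i) = Re (Rep_okubo y $ i $ j)"
      "Im (Rep_okubo y $ j $ i) = - Im (Rep_okubo y $ i $ j)" for i j
    by (metis cnj.sel)+
  have "Re (Rep_okubo x $ i $ j * Rep_okubo y $ j $ i) = Rep_okubo x $ i $ j \<bullet> Rep_okubo y $ i $ j" for i j
    by (simp add: inner_complex_def r(1)[of j i] r(2)[of j i])
  then show ?thesis
    unfolding inner_okubo.rep_eq trace_def matrix_matrix_mult_def inner_vec_def
    by simp
qed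

instance
proof
  fix x y z :: okubo and r :: real
  show "x \<bullet> y = y \<bullet> x" by (simp add: inner_okubo_Rep inner_commute)
  show "(x + y) \<bullet> z = x \<bullet> z + y \<bullet> z"
    by (simp add: inner_okubo_Rep plus_okubo.rep_eq inner_add_left add_divide_distrib)
  show "r *\<^sub>R x \<bullet> y = r * (x \<bullet> y)"
    by (simp add: inner_okubo_Rep scaleR_okubo.rep_eq)
  show "0 \<le> x \<bullet> x" by (simp add: inner_okubo_Rep)
  show "x \<bullet> x = 0 \<longleftrightarrow> x = 0"
    by (simp add: inner_okubo_Rep zero_okubo.rep_eq flip: Rep_okubo_inject)
qed (simp_all add: norm_okubo_def sgn_okubo_def dist_okubo_def uniformity_okubo_def open_okubo_def)

end

lemma okubo_norm_eq: "okubo_norm x = x \<bullet> x"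
  by transfer simp

lift_definition okubo_coords ::
    "real \<Rightarrow> real \<Rightarrow> complex \<Rightarrow> complex \<Rightarrow> complex \<Rightarrow> okubo" is
  "\<lambda>a b u v w. vector
     [vector [of_real (2 * a), sqrt 3 *\<^sub>R u, sqrt 3 *\<^sub>R v],
      vector [sqrt 3 *\<^sub>R cnj u, of_real (sqrt 3 * b - a), sqrt 3 *\<^sub>R w],
      vector [sqrt 3 *\<^sub>R cnj v, sqrt 3 *\<^sub>R cnj w, of_real (- sqrt 3 * b - a)]]"
  by (simp add: hermitian3_iff trace3 forall_3 complex_eq_iff)

lemma inner_okubo_coords:
  "okubo_coords a b u v w \<bullet> okubo_coords a' b' u' v' w'
     = a * a' + b * b' + u \<bullet> u' + v \<bullet> v' + w \<bullet> w'"
  by (simp add: inner_okubo_Rep okubo_coords.rep_eq inner_vec_def sum_3 inner_complex_def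
      algebra_simps)

lemma okubo_coords_cases:
  obtains a b u v w where "x = okubo_coords a b u v w"
proof -
  let ?X = "Rep_okubo x"
  have h: "cnj (?X $ j $ i) = ?X $ i $ j" for i j
    using Rep_okubo[of x] by (auto simp: hermitian3_iff)
  have t: "?X$1$1 + ?X$2$2 + ?X$3$3 = 0"
    using Rep_okubo[of x] by (auto simp: trace3)
  have d: "Im (?X $ i $ i) = 0" for i
    using h[of i i] by (simp add: complex_eq_iff)
  have hR: "Re (?X $ j $ i) = Re (?X $ i $ j)" "Im (?X $ j $ i) = - Im (?X $ i $ j)" for i j
    using h[of i j] by (auto simp: complex_eq_iff)
  have t': "Re (?X$3$3) = - Re (?X$1$1) - Re (?X$2$2)"
    using t by (simp add: complex_eq_iff)
  have t'': "2 * (sqrt 3 * Re (?X$1$1)) +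
      (2 * (sqrt 3 * Re (?X$2$2)) + 2 * (sqrt 3 * Re (?X$3$3))) = 0"
    unfolding t' by (simp add: algebra_simps)
  let ?s = "inverse (sqrt 3)"
  have "x = okubo_coords (Re (?X$1$1) / 2) ((Re (?X$2$2) - Re (?X$3$3)) / (2 * sqrt 3))
      (?s *\<^sub>R (?X$1$2)) (?s *\<^sub>R (?X$1$3)) (?s *\<^sub>R (?X$2$3))"
    using t' d hR[of 1 2] hR[of 1 3] hR[of 2 3]
    by (simp add: okubo_coords.rep_eq vec_eq_iff forall_3 complex_eq_iff field_simps t''
        flip: Rep_okubo_inject)
  then show ?thesis by (rule that)
qed

lemma zero_okubo_coords: "0 = okubo_coords 0 0 0 0 0"
  by (simp add: okubo_coords.rep_eq zero_okubo.rep_eq vec_eq_iff forall_3 flip: Rep_okubo_inject)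

lemma okubo_coords_inject:
  "okubo_coords a b u v w = okubo_coords a' b' u' v' w'
     \<longleftrightarrow> a = a' \<and> b = b' \<and> u = u' \<and> v = v' \<and> w = w'"
  by (auto simp: okubo_coords.rep_eq vec_eq_iff forall_3 complex_eq_iff simp flip: Rep_okubo_inject)

instantiation okubo :: euclidean_space
begin

definition Basis_okubo :: "okubo set" where
  "Basis_okubo =
    {okubo_coords 1 0 0 0 0, okubo_coords 0 1 0 0 0,
     okubo_coords 0 0 1 0 0, okubo_coords 0 0 \<i> 0 0,
     okubo_coords 0 0 0 1 0, okubo_coords 0 0 0 \<i> 0,
     okubo_coords 0 0 0 0 1, okubo_coords 0 0 0 0 \<i>}"

instance
proof
  show "(Basis :: okubo set) \<noteq> {}" and "finite (Basis :: okubo set)"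
    by (simp_all add: Basis_okubo_def)
  show "u \<bullet> v = (if u = v then 1 else 0)" if "u \<in> Basis" "v \<in> Basis" for u v :: okubo
    using that by (auto simp: Basis_okubo_def inner_okubo_coords okubo_coords_inject)
  show "(\<forall>u\<in>Basis. x \<bullet> u = 0) \<longleftrightarrow> x = 0" for x :: okubo
    by (rule okubo_coords_cases[of x])
      (auto simp: Basis_okubo_def inner_okubo_coords zero_okubo_coords okubo_coords_inject
        inner_complex_def complex_eq_iff)
qed

end

lemma DIM_okubo: "DIM(okubo) = 8"
  by (simp add: Basis_okubo_def okubo_coords_inject)

lemma okubo_e_idempotent: "okubo_e \<star> okubo_e = okubo_e"
  by (simp add: okubo_mult.rep_eq okubo_e.rep_eq vec_eq_iff forall_3 cscale_def
      matrix_matrix_mult_def sum_3 mat_def trace3 okubo_mu_def complex_eq_iff flip: Rep_okubo_inject)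

section \<open>The triality group\<close>

text \<open>In finite dimension every linear map is bounded, so \<open>V \<Rightarrow>\<^sub>L V\<close> is the space of all linear
  endomorphisms, as a normed space. \<open>okubo_Tri\<close> is also the realisation of \<open>Spin(8)\<close> by triples of
  linear maps of the Okubo algebra.\<close>

definition okubo_SO :: "(okubo \<Rightarrow>\<^sub>L okubo) set" where
  "okubo_SO = {A. lin_det (blinfun_apply A) = 1 \<and> (\<forall>x. okubo_norm (A x) = okubo_norm x)}"

definition okubo_Tri :: "((okubo \<Rightarrow>\<^sub>L okubo) \<times> (okubo \<Rightarrow>\<^sub>L okubo) \<times> (okubo \<Rightarrow>\<^sub>L okubo)) set" where
  "okubo_Tri = {(A, B, C). A \<in> okubo_SO \<and> B \<in> okubo_SO \<and> C \<in> okubo_SO \<and>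
     (\<forall>s x. B (s \<star> x) = C s \<star> A x)}"

definition okubo_Tri_group ::
    "((okubo \<Rightarrow>\<^sub>L okubo) \<times> (okubo \<Rightarrow>\<^sub>L okubo) \<times> (okubo \<Rightarrow>\<^sub>L okubo)) monoid" where
  "okubo_Tri_group = \<lparr>carrier = okubo_Tri,
     monoid.mult = (\<lambda>(A, B, C) (A', B', C'). (A o\<^sub>L A', B o\<^sub>L B', C o\<^sub>L C')),
     one = (id_blinfun, id_blinfun, id_blinfun)\<rparr>"

section \<open>Octonions and the compact group of type G2\<close>

text \<open>Cayley-Dickson doubling of the complex numbers to the quaternions and then to the octonions:
  \<open>(a, b) (c, d) = (a c - conj d b, d a + b conj c)\<close>.\<close>

type_synonym quaternion = "complex \<times> complex"
type_synonym octonion = "quaternion \<times> quaternion"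

fun quat_cnj :: "quaternion \<Rightarrow> quaternion" where
  "quat_cnj (a, b) = (cnj a, - b)"

fun quat_mult :: "quaternion \<Rightarrow> quaternion \<Rightarrow> quaternion" where
  "quat_mult (a, b) (c, d) = (a * c - cnj d * b, d * a + b * cnj c)"

fun oct_mult :: "octonion \<Rightarrow> octonion \<Rightarrow> octonion" where
  "oct_mult (a, b) (c, d) =
     (quat_mult a c - quat_mult (quat_cnj d) b, quat_mult d a + quat_mult b (quat_cnj c))"

definition G2_compact :: "(octonion \<Rightarrow>\<^sub>L octonion) monoid" where
  "G2_compact = \<lparr>carrier = {A. bij (blinfun_apply A) \<and>
       (\<forall>x y. A (oct_mult x y) = oct_mult (A x) (A y))},
     monoid.mult = (o\<^sub>L), one = id_blinfun\<rparr>"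

section \<open>Isomorphism of Lie groups of linear maps\<close>

text \<open>\<open>Ck_on k f U\<close>, for \<open>U\<close> open and a finite-dimensional domain, says that \<open>f\<close> is of class
  \<open>C\<^sup>k\<close> on \<open>U\<close>. A map on an arbitrary subset is smooth if it locally extends to smooth maps on
  open sets of the ambient space. For a closed subgroup of a group of invertible linear maps,
  which is an embedded submanifold, this is smoothness for its Lie group structure.\<close>

primrec Ck_on ::
    "nat \<Rightarrow> ('a::real_normed_vector \<Rightarrow> 'b::real_normed_vector) \<Rightarrow> 'a set \<Rightarrow> bool" where
  "Ck_on 0 f U \<longleftrightarrow> continuous_on U f"
| "Ck_on (Suc k) f U \<longleftrightarrow> (\<forall>x\<in>U. f differentiable (at x)) \<and>
     (\<forall>v. Ck_on k (\<lambda>x. frechet_derivative f (at x) v) U)"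

definition smooth_map_on ::
    "'a::real_normed_vector set \<Rightarrow> ('a \<Rightarrow> 'b::real_normed_vector) \<Rightarrow> bool" where
  "smooth_map_on S f \<longleftrightarrow>
     (\<forall>x\<in>S. \<exists>U F. open U \<and> x \<in> U \<and> (\<forall>k. Ck_on k F U) \<and> (\<forall>y\<in>S \<inter> U. F y = f y))"

definition lie_isomorphic ::
    "'a::real_normed_vector monoid \<Rightarrow> 'b::real_normed_vector monoid \<Rightarrow> bool" (infix \<open>\<cong>\<^sub>L\<close> 60) where
  "G \<cong>\<^sub>L H \<longleftrightarrow> (\<exists>h \<in> Group.iso G H. smooth_map_on (carrier G) h \<and>
     smooth_map_on (carrier H) (inv_into (carrier G) h))"

end

theory Submission
  imports Defs
begin

text \<open>
  The Okubo algebra is a symmetric composition algebra: \<open>x \<star> (y \<star> x) = n(x) y = (x \<star> y) \<star> x\<close>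
  (lemma \<open>okubo_symmetric_composition\<close>). In particular left and right multiplication by the idempotent
  \<open>e\<close> are mutually inverse isometries, and \<open>x \<odot> y = (e \<star> x) \<star> (y \<star> e)\<close> is a multiplication with unit
  \<open>e\<close> and multiplicative norm, that is, a copy of the octonions; an explicit isomorphism is
  \<open>okubo_of_octonion\<close>.

  Let \<open>(A, B, C)\<close> be a triality triple fixing \<open>e\<close>. Putting \<open>e\<close> for one of the arguments of the triality
  relation gives \<open>A x = B (e \<star> x) \<star> e\<close> and \<open>C x = e \<star> B (x \<star> e)\<close>, and inserting this into the relation
  says precisely that \<open>B\<close> is an automorphism of \<open>\<odot>\<close>. Hence the triple is determined by \<open>B\<close>, and
  \<open>B\<close> ranges over a copy of the automorphism group of the octonions, provided that every automorphism
  of \<open>\<odot>\<close> lies in the special orthogonal group. It preserves the norm because the norm occurs in the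
  quadratic equation of each element (\<open>okubo_dot_automorphism_orthogonal\<close>). The sign of the
  determinant (\<open>okubo_dot_automorphism_lin_det\<close>) is settled without using connectedness of the group: an
  orthogonal map of determinant \<open>-1\<close> sends some unit vector \<open>u\<close> to \<open>- u\<close>, which makes an automorphism
  antilinear for the complex structure given by left multiplication by \<open>u\<close>, and an antilinear
  isometry of a complex vector space of even dimension has real determinant 1.

  The passage from \<open>B\<close> to the triple, and back, is the restriction of a linear map between spaces of
  endomorphisms. Therefore the group isomorphism is smooth in both directions. That the two descriptions
  of the group of triples agree is a cancellation of \<open>e\<close> (\<open>Tri_fixing_e_iff\<close>).
\<close>

section \<open>Determinants of orthogonal maps\<close>

context
  fixes b :: "'n::finite \<Rightarrow> 'a::euclidean_space"
  assumes b: "bij_betw b UNIV Basis"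
begin

lemma lin_det_compose:
  assumes "linear f" "linear g"
  shows "lin_det (f \<circ> g) = lin_det f * lin_det (g :: 'a \<Rightarrow> 'a)"
proof -
  have "f (g (b j)) \<bullet> b i = (\<Sum>k\<in>UNIV. (f (b k) \<bullet> b i) * (g (b j) \<bullet> b k))" for i j
  proof -
    have "g (b j) = (\<Sum>k\<in>UNIV. (g (b j) \<bullet> b k) *\<^sub>R b k)"
      using sum.reindex_bij_betw[OF b, of "\<lambda>c. (g (b j) \<bullet> c) *\<^sub>R c"]
      by (simp add: euclidean_representation)
    then have "f (g (b j)) = (\<Sum>k\<in>UNIV. (g (b j) \<bullet> b k) *\<^sub>R f (b k))"
      using linear_sum[OF \<open>linear f\<close>] linear_scale[OF \<open>linear f\<close>]
      by (metis (no_types, lifting) sum.cong)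
    then show ?thesis by (simp add: inner_sum_left mult.commute)
  qed
  then have "(\<chi> i j. (f \<circ> g) (b j) \<bullet> b i)
      = (\<chi> i j. f (b j) \<bullet> b i) ** (\<chi> i j. g (b j) \<bullet> b i)"
    by (simp add: matrix_matrix_mult_def vec_eq_iff)
  then show ?thesis by (simp add: lin_det_eq_det[OF b] det_mul)
qed

lemma lin_det_id: "lin_det (id :: 'a \<Rightarrow> 'a) = 1"
proof -
  have "b j \<bullet> b i = (if i = j then 1 else 0)" for i j
    using bij_betwE[OF b] bij_betw_imp_inj_on[OF b] by (simp add: inner_Basis inj_eq eq_commute)
  then have "(\<chi> i j. id (b j) \<bullet> b i) = (mat 1 :: real^'n^'n)"
    by (simp add: mat_def vec_eq_iff)
  then show ?thesis by (simp add: lin_det_eq_det[OF b])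
qed

lemma lin_det_adjoint:
  assumes "linear f" shows "lin_det (adjoint f) = lin_det (f :: 'a \<Rightarrow> 'a)"
proof -
  have "(\<chi> i j. adjoint f (b j) \<bullet> b i) = transpose (\<chi> i j. f (b j) \<bullet> b i)"
    by (simp add: transpose_def vec_eq_iff adjoint_works[OF assms] inner_commute)
  then show ?thesis by (simp add: lin_det_eq_det[OF b] det_transpose)
qed

lemma lin_det_eq_0_imp_kernel:
  assumes f: "linear f" and "lin_det (f :: 'a \<Rightarrow> 'a) = 0"
  obtains u where "u \<noteq> 0" "f u = 0"
proof -
  have "\<not> inj f"
  proof
    assume "inj f"
    then obtain g where "linear g" "\<forall>x. f (g x) = x"
      using linear_injective_isomorphism[OF f] by blast
    then have "lin_det f * lin_det g = 1"
      using lin_det_compose[OF f] lin_det_id by (metis comp_apply eq_id_iff)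
    with assms(2) show False by simp
  qed
  then show ?thesis using that linear_injective_0[OF f] by blast
qed

lemma orthogonal_adjoint_compose:
  assumes f: "orthogonal_transformation (f :: 'a \<Rightarrow> 'a)" shows "adjoint f \<circ> f = id"
  using f by (auto simp: fun_eq_iff orthogonal_transformation_def
      adjoint_works[OF orthogonal_transformation_linear[OF f]]
      intro: vector_eq_ldot[THEN iffD1])

lemma orthogonal_lin_det:
  assumes "orthogonal_transformation (f :: 'a \<Rightarrow> 'a)"
  shows "lin_det f = 1 \<or> lin_det f = - 1"
proof -
  have f: "linear f" using assms by (rule orthogonal_transformation_linear)
  have "lin_det f * lin_det f = 1"
    using orthogonal_adjoint_compose[OF assms] lin_det_compose[OF adjoint_linear[OF f] f] lin_det_adjoint[OF f] lin_det_id by simp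
  then show ?thesis by (simp add: square_eq_1_iff)
qed

text \<open>Writing \<open>B\<^sup>T\<close> for the adjoint, \<open>I + B = B (I + B)\<^sup>T\<close>; taking determinants shows that
\<open>I + B\<close> is singular.\<close>

lemma orthogonal_lin_det_minus_1_imp_eigenvector:
  assumes B: "orthogonal_transformation (B :: 'a \<Rightarrow> 'a)" and det: "lin_det B = - 1"
  obtains u where "norm u = 1" "B u = - u"
proof -
  have l: "linear B" using B by (rule orthogonal_transformation_linear)
  let ?S = "\<lambda>x. x + B x"
  have S: "linear ?S" using l by (simp add: linear_compose_add module_hom_ident linear_ident)
  have "x + adjoint B x = adjoint ?S x" for x
  proof -
    have "adjoint ?S x \<bullet> y = (x + adjoint B x) \<bullet> y" for y
      by (simp add: inner_add adjoint_works[OF S] adjoint_works[OF l]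
          adjoint_clauses[OF S] adjoint_clauses[OF l])
    then show ?thesis using vector_eq_rdot by metis
  qed
  then have "B (adjoint ?S x) = ?S x" for x
  proof -
    have "B (adjoint B x) = x"
    proof -
      have "surj B" by (rule orthogonal_transformation_surj[OF B])
      then show ?thesis using orthogonal_adjoint_compose[OF B] by (metis comp_apply id_apply surjD)
    qed
    then show ?thesis
      using \<open>\<And>x. x + adjoint B x = adjoint ?S x\<close>[of x, symmetric]
      by (simp add: linear_add[OF l])
  qed
  then have "B \<circ> adjoint ?S = ?S" by (simp add: fun_eq_iff)
  then have "lin_det ?S = lin_det B * lin_det ?S"
    using lin_det_compose[OF l adjoint_linear[OF S]] lin_det_adjoint[OF S] by simp
  with det have "lin_det ?S = 0" by simp
  then obtain u where u: "u \<noteq> 0" "u + B u = 0"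
    using lin_det_eq_0_imp_kernel[OF S] by metis
  show ?thesis
  proof (rule that[of "u /\<^sub>R norm u"])
    show "B (u /\<^sub>R norm u) = - (u /\<^sub>R norm u)"
      using u(2) by (simp add: linear_scale[OF l] eq_neg_iff_add_eq_0 add.commute
          flip: scaleR_right_distrib scaleR_minus_right)
  qed (use u in simp)
qed

text \<open>\<open>J\<close> turns the space into a complex vector space on which \<open>M\<close> is complex linear, and the real
determinant of a complex linear map is the squared modulus of its complex determinant. The proof
avoids complex determinants. If the determinant were \<open>-1\<close>, then \<open>M v = - v\<close> for some unit vector
\<open>v\<close>, and \<open>M\<close> is \<open>-1\<close> on the plane spanned by \<open>v\<close> and \<open>J v\<close>. The half turn \<open>R\<close> in this plane
commutes with \<open>J\<close> and has determinant 1, being the square of the quarter turn \<open>Q\<close>; so \<open>R \<circ> M\<close>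
satisfies the same hypotheses, with the same determinant and more fixed vectors.\<close>

lemma orthogonal_commuting_with_complex_structure_lin_det:
  fixes J M :: "'a \<Rightarrow> 'a"
  assumes J: "orthogonal_transformation J" and JJ: "\<And>x. J (J x) = - x"
    and M: "orthogonal_transformation M" and MJ: "\<And>x. M (J x) = J (M x)"
  shows "lin_det M = 1"
  using M MJ
proof (induction "DIM('a) - dim {x. M x = x}" arbitrary: M rule: less_induct)
  case less
  note M = less.prems(1) and MJ = less.prems(2)
  have lJ: "linear J" and lM: "linear M"
    using J M by (simp_all add: orthogonal_transformation_linear)
  show ?case
  proof (rule ccontr)
    assume "lin_det M \<noteq> 1"
    with orthogonal_lin_det[OF M] have "lin_det M = - 1" by simp
    with orthogonal_lin_det_minus_1_imp_eigenvector[OF M]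
    obtain v where v: "norm v = 1" "M v = - v" by blast
    have ip: "J x \<bullet> J y = x \<bullet> y" "M x \<bullet> M y = x \<bullet> y" for x y
      using J M by (simp_all add: orthogonal_transformation_def)
    have skew: "J x \<bullet> y = - (x \<bullet> J y)" for x y
      using ip(1)[of x "J y"] by (simp add: JJ)
    have vv: "v \<bullet> v = 1" using v(1) by (simp add: dot_square_norm)
    have vJv: "v \<bullet> J v = 0" using skew[of v v] by (simp add: inner_commute)
    \<comment> \<open>orthogonal projection onto the complex line of \<open>v\<close>\<close>
    define P where "P x = (x \<bullet> v) *\<^sub>R v + (x \<bullet> J v) *\<^sub>R J v" for x
    \<comment> \<open>quarter turn and half turn of that line\<close>
    define Q where "Q x = x - P x + J (P x)" for x
    define R where "R x = x - 2 *\<^sub>R P x" for x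
    have lP: "linear P"
      by (rule linearI) (simp_all add: P_def inner_add_left algebra_simps)
    have lQ: "linear Q" and lR: "linear R"
      unfolding Q_def R_def
      by (auto intro!: linearI simp: linear_add[OF lP] linear_scale[OF lP]
          linear_add[OF lJ] linear_scale[OF lJ] algebra_simps)
    have PJ: "P (J x) = J (P x)" for x
      by (simp add: P_def linear_add[OF lJ] linear_scale[OF lJ] JJ skew[of x v] ip(1))
    have PP: "P (P x) = P x" for x
      using vv vJv by (simp add: P_def inner_add_left ip(1) inner_commute[of "J v" v])
    have P_sym: "P x \<bullet> y = x \<bullet> P y" for x y
      by (simp add: P_def inner_add_left inner_add_right inner_commute[of y] mult.commute)
    have "R = Q \<circ> Q"
      by (simp add: fun_eq_iff R_def Q_def linear_add[OF lP] linear_diff[OF lP]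
          linear_add[OF lJ] linear_diff[OF lJ] PJ PP JJ scaleR_2)
    then have "lin_det R = lin_det Q * lin_det Q"
      using lin_det_compose[OF lQ lQ] by simp
    then have "lin_det R \<ge> 0" by simp
    have R: "orthogonal_transformation R"
    proof -
      have "R x \<bullet> R y = x \<bullet> y" for x y
      proof -
        have "P x \<bullet> P y = x \<bullet> P (P y)" by (rule P_sym)
        then show ?thesis
          using P_sym[of x y] by (simp add: R_def inner_diff PP)
      qed
      then show ?thesis using lR by (simp add: orthogonal_transformation_def)
    qed
    with orthogonal_lin_det[OF R] \<open>lin_det R \<ge> 0\<close> have detR: "lin_det R = 1" by simp
    have detRM: "lin_det (R \<circ> M) = lin_det M"
      using lin_det_compose[OF lR lM] detR by simp
    have fix_subset: "{x. M x = x} \<subseteq> {x. (R \<circ> M) x = x}"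
    proof clarsimp
      fix x assume x: "M x = x"
      have "x \<bullet> v = 0" using ip(2)[of x v] x v(2) by simp
      moreover have "x \<bullet> J v = 0" using ip(2)[of x "J v"] x v(2)
        by (simp add: MJ linear_neg[OF lJ])
      ultimately show "R x = x" by (simp add: R_def P_def)
    qed
    have "(R \<circ> M) v = v"
      using vv vJv by (simp add: v(2) linear_neg[OF lR]) (simp add: R_def P_def scaleR_2)
    moreover have "M v \<noteq> v"
    proof
      assume "M v = v"
      then have "v \<bullet> v = - (v \<bullet> v)" using v(2) by (metis inner_minus_left)
      with vv show False by simp
    qed
    ultimately have "{x. M x = x} \<subset> {x. (R \<circ> M) x = x}" using fix_subset by blast
    moreover have "subspace {x. M x = x}" "subspace {x. (R \<circ> M) x = x}"
      using lM lR by (auto simp: subspace_def linear_0 linear_add linear_scale)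
    ultimately have "dim {x. M x = x} < dim {x. (R \<circ> M) x = x}"
      by (metis dim_psubset span_eq_iff)
    moreover have "dim {x. (R \<circ> M) x = x} \<le> DIM('a)" by (rule dim_subset_UNIV)
    ultimately have "DIM('a) - dim {x. (R \<circ> M) x = x} < DIM('a) - dim {x. M x = x}"
      by linarith
    moreover have "orthogonal_transformation (R \<circ> M)"
      using R M by (rule orthogonal_transformation_compose)
    moreover have "(R \<circ> M) (J x) = J ((R \<circ> M) x)" for x
      by (simp add: R_def PJ MJ linear_diff[OF lJ] linear_scale[OF lJ])
    ultimately have "lin_det (R \<circ> M) = 1" by (rule less.hyps)
    with detRM \<open>lin_det M = - 1\<close> show False by simp
  qed
qed

end

section \<open>The Okubo algebra as a symmetric composition algebra\<close>

lemma okubo_mu_powers: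
  "okubo_mu * cnj okubo_mu = 1 / 3"
  "okubo_mu * okubo_mu + cnj okubo_mu * cnj okubo_mu = 1 / 3"
  by (simp_all add: okubo_mu_def complex_eq_iff)

lemma cscale_simps:
  "cscale c X ** Y = cscale c (X ** Y)" "X ** cscale c Y = cscale c (X ** Y)"
  "cscale c (cscale d X) = cscale (c * d) X"
  "cscale c (X + Y) = cscale c X + cscale c Y" "cscale c (X - Y) = cscale c X - cscale c Y"
  "mat c ** X = cscale c X" "X ** mat c = cscale c X"
  by (simp_all add: cscale_def matrix_matrix_mult_def vec_eq_iff sum_3 mat_def forall_3 algebra_simps)

lemma matrix_distrib:
  fixes X Y Z :: "complex^3^3"
  shows "X ** (Y + Z) = X ** Y + X ** Z" "(X + Y) ** Z = X ** Z + Y ** Z"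
    "X ** (Y - Z) = X ** Y - X ** Z" "(X - Y) ** Z = X ** Z - Y ** Z"
  by (simp_all add: matrix_matrix_mult_def vec_eq_iff sum_3 algebra_simps)

text \<open>The polarisation of \<open>X\<^sup>3 = (tr X\<^sup>2 / 2) X + det X\<close>, the Cayley--Hamilton identity of a traceless
matrix \<open>X\<close>.\<close>

lemma linearised_cayley_hamilton:
  fixes X Y :: "complex^3^3"
  assumes "trace X = 0" "trace Y = 0"
  shows "X ** X ** Y + X ** Y ** X + Y ** X ** X
    = cscale (trace (X ** X) / 2) Y + cscale (trace (X ** Y)) X + mat (trace (X ** X ** Y))"
proof -
  have x: "X$3$3 = - X$1$1 - X$2$2" and y: "Y$3$3 = - Y$1$1 - Y$2$2"
    using assms by (auto simp: trace3 algebra_simps eq_neg_iff_add_eq_0)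
  show ?thesis
    by (simp add: vec_eq_iff forall_3 cscale_def matrix_matrix_mult_def trace3 sum_3 mat_def x y
        field_simps)
qed

lemma bilinear_okubo_mult: "bilinear (\<star>)"
proof -
  have "(x + y) \<star> z = x \<star> z + y \<star> z" "z \<star> (x + y) = z \<star> x + z \<star> y" for x y z
    by (simp_all add: okubo_mult.rep_eq plus_okubo.rep_eq vec_eq_iff forall_3 cscale_def
        matrix_matrix_mult_def sum_3 mat_def trace3 field_simps flip: Rep_okubo_inject)
  moreover have "(r *\<^sub>R x) \<star> z = r *\<^sub>R (x \<star> z)" "z \<star> (r *\<^sub>R x) = r *\<^sub>R (z \<star> x)" for r x z
    by (simp_all add: okubo_mult.rep_eq scaleR_okubo.rep_eq vec_eq_iff forall_3 cscale_def
        matrix_matrix_mult_def sum_3 mat_def trace3 field_simps scaleR_conv_of_real[where 'a=complex]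
        flip: Rep_okubo_inject)
  ultimately show ?thesis by (simp add: bilinear_def linear_iff)
qed

lemma okubo_inner_complex: "complex_of_real (x \<bullet> y) = trace (Rep_okubo x ** Rep_okubo y) / 6"
proof -
  have h: "cnj (Rep_okubo z $ i $ j) = Rep_okubo z $ j $ i" for z i j
    using Rep_okubo[of z] by (auto simp: hermitian3_iff)
  have "cnj (trace (Rep_okubo x ** Rep_okubo y)) = trace (Rep_okubo x ** Rep_okubo y)"
    by (simp add: trace3 matrix_matrix_mult_def sum_3 h algebra_simps)
  then have "Im (trace (Rep_okubo x ** Rep_okubo y)) = 0"
    by (metis Reals_cnj_iff complex_is_Real_iff)
  then show ?thesis
    by (simp add: inner_okubo.rep_eq complex_eq_iff)
qed

text \<open>The constant \<open>\<mu>\<close> is chosen for this identity: since \<open>\<mu> \<mu>' = \<mu>\<^sup>2 + \<mu>'\<^sup>2 = 1/3\<close> for the conjugate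
\<open>\<mu>'\<close>, expanding \<open>x \<star> (y \<star> x)\<close> gives a third of \<open>XXY + XYX + YXX - tr(XY) X\<close>, up to a scalar matrix. By the
linearised Cayley--Hamilton identity this is \<open>tr(X\<^sup>2) Y / 6\<close>, again up to a scalar matrix, and the
scalar matrices cancel because both sides are traceless.\<close>

lemma okubo_symmetric_composition:
  "x \<star> (y \<star> x) = (x \<bullet> x) *\<^sub>R y" "(x \<star> y) \<star> x = (x \<bullet> x) *\<^sub>R y"
proof -
  let ?X = "Rep_okubo x" and ?Y = "Rep_okubo y"
  let ?m = okubo_mu and ?n = "cnj okubo_mu"
  define S where "S = ?X ** ?X ** ?Y + ?X ** ?Y ** ?X + ?Y ** ?X ** ?X"
  define t where "t = trace (?X ** ?Y)"
  have tr: "trace ?X = 0" "trace ?Y = 0" using Rep_okubo by auto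
  have t': "trace (?Y ** ?X) = t" unfolding t_def by (rule trace_mul_sym)
  have S: "S = cscale (of_real (3 * (x \<bullet> x))) ?Y + cscale t ?X + mat (trace (?X ** ?X ** ?Y))"
    unfolding S_def t_def linearised_cayley_hamilton[OF tr] of_real_mult okubo_inner_complex by simp
  have *: "\<exists>c. Rep_okubo z = cscale (1/3) S - cscale (t/3) ?X - mat c"
    if z: "z = x \<star> (y \<star> x) \<or> z = (x \<star> y) \<star> x" for z
    using z
  proof
    assume "z = x \<star> (y \<star> x)"
    then have "Rep_okubo z = cscale (?m * ?m + ?n * ?n) (?X ** ?Y ** ?X)
        + cscale (?m * ?n) (?X ** ?X ** ?Y + ?Y ** ?X ** ?X) - cscale ((?m + ?n) * (t / 3)) ?X
        - mat (trace (?X ** Rep_okubo (y \<star> x)) / 3)"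
      by (simp add: okubo_mult.rep_eq cscale_simps matrix_distrib
          matrix_mul_assoc t')
        (simp add: cscale_def vec_eq_iff algebra_simps)
    then show ?thesis
      unfolding okubo_mu_powers okubo_mu_sum S_def
      by (intro exI[of _ "trace (?X ** Rep_okubo (y \<star> x)) / 3"])
        (simp add: cscale_simps algebra_simps)
  next
    assume "z = (x \<star> y) \<star> x"
    then have "Rep_okubo z = cscale (?m * ?m + ?n * ?n) (?X ** ?Y ** ?X)
        + cscale (?m * ?n) (?X ** ?X ** ?Y + ?Y ** ?X ** ?X) - cscale ((?m + ?n) * (t / 3)) ?X
        - mat (trace (Rep_okubo (x \<star> y) ** ?X) / 3)"
      by (simp add: okubo_mult.rep_eq cscale_simps matrix_distrib
          matrix_mul_assoc t_def)
        (simp add: cscale_def vec_eq_iff algebra_simps)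
    then show ?thesis
      unfolding okubo_mu_powers okubo_mu_sum S_def
      by (intro exI[of _ "trace (Rep_okubo (x \<star> y) ** ?X) / 3"])
        (simp add: cscale_simps algebra_simps)
  qed
  have **: "z = (x \<bullet> x) *\<^sub>R y" if z: "z = x \<star> (y \<star> x) \<or> z = (x \<star> y) \<star> x" for z
  proof -
    obtain c where c: "Rep_okubo z = cscale (1/3) S - cscale (t/3) ?X - mat c"
      using *[OF z] by blast
    have z: "Rep_okubo z = cscale (of_real (x \<bullet> x)) ?Y
        - mat (c - trace (?X ** ?X ** ?Y) / 3)"
      unfolding c S by (simp add: cscale_def vec_eq_iff mat_def algebra_simps)
    define d where "d = c - trace (?X ** ?X ** ?Y) / 3"
    have "trace (Rep_okubo z) = 0" using Rep_okubo by auto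
    then have "of_real (x \<bullet> x) * trace ?Y - 3 * d = 0"
      unfolding z d_def[symmetric] by (simp add: trace3 cscale_def mat_def algebra_simps)
    then have "d = 0" using tr by simp
    then have "Rep_okubo z = cscale (of_real (x \<bullet> x)) ?Y"
      unfolding z d_def[symmetric] by (simp add: mat_def vec_eq_iff)
    then show ?thesis
      by (simp add: scaleR_okubo.rep_eq cscale_def vec_eq_iff scaleR_conv_of_real[where 'a=complex]
          flip: Rep_okubo_inject)
  qed
  show "x \<star> (y \<star> x) = (x \<bullet> x) *\<^sub>R y" "(x \<star> y) \<star> x = (x \<bullet> x) *\<^sub>R y"
    by (rule **; simp)+
qed

lemmas okubo_linear =
  bilinear_ladd[OF bilinear_okubo_mult] bilinear_radd[OF bilinear_okubo_mult]
  bilinear_lmul[OF bilinear_okubo_mult] bilinear_rmul[OF bilinear_okubo_mult]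
  bilinear_lneg[OF bilinear_okubo_mult] bilinear_rneg[OF bilinear_okubo_mult]
  bilinear_lsub[OF bilinear_okubo_mult] bilinear_rsub[OF bilinear_okubo_mult]

lemma okubo_symmetric_composition_polarised:
  "x \<star> (y \<star> z) + z \<star> (y \<star> x) = (2 * (x \<bullet> z)) *\<^sub>R y"
  "(x \<star> y) \<star> z + (z \<star> y) \<star> x = (2 * (x \<bullet> z)) *\<^sub>R y"
  using okubo_symmetric_composition[of "x + z" y]
  by (simp_all add: okubo_linear okubo_symmetric_composition inner_add inner_commute[of z x]
      algebra_simps flip: scaleR_2)

text \<open>Compute \<open>((x \<star> y) \<star> x) \<star> (x \<star> y)\<close> in two ways, as \<open>(p \<star> x) \<star> p\<close> with \<open>p = x \<star> y\<close> and by
simplifying the left factor.\<close>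

lemma okubo_norm_mult: "(x \<star> y) \<bullet> (x \<star> y) = (x \<bullet> x) * (y \<bullet> y)"
proof (cases "x = 0")
  case False
  have "((x \<star> y) \<bullet> (x \<star> y)) *\<^sub>R x = ((x \<star> y) \<star> x) \<star> (x \<star> y)"
    by (rule okubo_symmetric_composition(2)[symmetric])
  also have "\<dots> = ((x \<bullet> x) * (y \<bullet> y)) *\<^sub>R x"
    by (simp add: okubo_symmetric_composition okubo_linear)
  finally show ?thesis using False by simp
qed (use bilinear_lzero[OF bilinear_okubo_mult] in simp)

lemma okubo_inner_mult_right: "(x \<star> z) \<bullet> (y \<star> z) = (x \<bullet> y) * (z \<bullet> z)"
  using okubo_norm_mult[of "x + y" z] okubo_norm_mult[of x z] okubo_norm_mult[of y z]
  by (simp add: okubo_linear inner_add inner_commute[of "y \<star> z" "x \<star> z"] inner_commute[of y x]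
      algebra_simps)

lemma okubo_inner_mult_left: "(z \<star> x) \<bullet> (z \<star> y) = (x \<bullet> y) * (z \<bullet> z)"
  using okubo_norm_mult[of z "x + y"] okubo_norm_mult[of z x] okubo_norm_mult[of z y]
  by (simp add: okubo_linear inner_add inner_commute[of "z \<star> y" "z \<star> x"] inner_commute[of y x]
      algebra_simps)

lemma okubo_e_coords: "okubo_e = okubo_coords 1 0 0 0 0"
  by (simp add: okubo_coords.rep_eq okubo_e.rep_eq vec_eq_iff forall_3 flip: Rep_okubo_inject)

lemma inner_okubo_e: "okubo_e \<bullet> okubo_e = 1"
  by (simp add: okubo_e_coords inner_okubo_coords)

lemma okubo_e_cancel: "okubo_e \<star> (x \<star> okubo_e) = x" "(okubo_e \<star> x) \<star> okubo_e = x"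
  by (simp_all add: okubo_symmetric_composition inner_okubo_e)

section \<open>The octonion product on the Okubo algebra\<close>

text \<open>Left and right multiplication by \<open>e\<close> are mutually inverse isometries. Kaplansky's trick of twisting
the product by them yields a composition algebra with unit \<open>e\<close> for the same norm, hence a copy of the
octonions.\<close>

definition okubo_dot :: "okubo \<Rightarrow> okubo \<Rightarrow> okubo" (infixl \<open>\<odot>\<close> 70) where
  "x \<odot> y = (okubo_e \<star> x) \<star> (y \<star> okubo_e)"

lemma okubo_dot_linear:
  "(x + y) \<odot> z = x \<odot> z + y \<odot> z" "x \<odot> (y + z) = x \<odot> y + x \<odot> z"
  "(r *\<^sub>R x) \<odot> z = r *\<^sub>R (x \<odot> z)" "x \<odot> (r *\<^sub>R z) = r *\<^sub>R (x \<odot> z)"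
  "(- x) \<odot> z = - (x \<odot> z)" "x \<odot> (- z) = - (x \<odot> z)"
  by (simp_all add: okubo_dot_def okubo_linear)

lemma okubo_dot_unit: "okubo_e \<odot> x = x" "x \<odot> okubo_e = x"
  by (simp_all add: okubo_dot_def okubo_e_idempotent okubo_e_cancel)

lemma okubo_dot_orthogonal:
  assumes "w \<bullet> w = 1" shows "orthogonal_transformation ((\<odot>) w)"
proof -
  have "linear ((\<odot>) w)" by (rule linearI) (simp_all add: okubo_dot_linear)
  then show ?thesis
    using assms
    by (simp add: orthogonal_transformation_def okubo_dot_def okubo_inner_mult_left
        okubo_inner_mult_right inner_okubo_e)
qed

text \<open>The quadratic equation satisfied by every element of a unital composition algebra. Here it is the
polarised identity for \<open>(e \<star> x) \<star> (x \<star> e)\<close>, whose other term \<open>((x \<star> e) \<star> x) \<star> e\<close> collapses to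
\<open>n(x) e\<close>.\<close>

lemma okubo_dot_square: "x \<odot> x = (2 * (x \<bullet> okubo_e)) *\<^sub>R x - (x \<bullet> x) *\<^sub>R okubo_e"
proof -
  have "okubo_e \<bullet> (x \<star> okubo_e) = x \<bullet> okubo_e"
    using okubo_inner_mult_right[of okubo_e okubo_e x]
    by (simp add: okubo_e_idempotent inner_okubo_e inner_commute)
  then show ?thesis
    using okubo_symmetric_composition_polarised(2)[of okubo_e x "x \<star> okubo_e"]
    by (simp add: okubo_dot_def okubo_symmetric_composition okubo_linear okubo_e_idempotent
        algebra_simps)
qed

text \<open>As \<open>e \<star> u\<close> is orthogonal to \<open>e\<close>, the polarised identity gives
\<open>(u \<odot> y) \<star> e = - (y \<star> (e \<star> u))\<close>. Hence \<open>u \<odot> (u \<odot> y)\<close> has the form \<open>- (z \<star> (y \<star> z))\<close> with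
\<open>z = e \<star> u\<close>.\<close>

lemma okubo_dot_alternative:
  assumes "u \<bullet> okubo_e = 0" shows "u \<odot> (u \<odot> y) = - ((u \<bullet> u) *\<^sub>R y)"
proof -
  let ?e = okubo_e
  have "(?e \<star> u) \<bullet> ?e = u \<bullet> ?e"
    using okubo_inner_mult_left[of ?e u ?e] by (simp add: okubo_e_idempotent inner_okubo_e)
  then have "(u \<odot> y) \<star> ?e = - (y \<star> (?e \<star> u))"
    using okubo_symmetric_composition_polarised(2)[of "?e \<star> u" "y \<star> ?e" ?e] assms
    by (simp add: okubo_dot_def okubo_e_cancel eq_neg_iff_add_eq_0)
  moreover have "(?e \<star> u) \<bullet> (?e \<star> u) = u \<bullet> u"
    by (simp add: okubo_norm_mult inner_okubo_e)
  ultimately show ?thesis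
    unfolding okubo_dot_def[of u "u \<odot> y"]
    by (simp add: okubo_linear okubo_symmetric_composition)
qed

text \<open>Left multiplications by vectors orthogonal to \<open>e\<close> satisfy the relations of a Clifford algebra.\<close>

lemma okubo_dot_anticommute:
  assumes "u \<bullet> okubo_e = 0" "w \<bullet> okubo_e = 0" "u \<bullet> w = 0"
  shows "u \<odot> (w \<odot> y) = - (w \<odot> (u \<odot> y))"
  using okubo_dot_alternative[of "u + w" y] okubo_dot_alternative[of u y]
    okubo_dot_alternative[of w y] assms
  by (simp add: okubo_dot_linear inner_add inner_commute[of w u] algebra_simps eq_neg_iff_add_eq_0)

section \<open>Automorphisms of the octonion product\<close>

definition okubo_dot_automorphism :: "(okubo \<Rightarrow> okubo) \<Rightarrow> bool" where
  "okubo_dot_automorphism B \<longleftrightarrow> linear B \<and> bij B \<and> (\<forall>x y. B (x \<odot> y) = B x \<odot> B y)"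

lemma okubo_dot_automorphism_unit:
  assumes "okubo_dot_automorphism B" shows "B okubo_e = okubo_e"
proof -
  obtain x where "B x = okubo_e"
    using assms by (metis bij_is_surj okubo_dot_automorphism_def surjD)
  then show ?thesis
    using assms okubo_dot_unit unfolding okubo_dot_automorphism_def by metis
qed

text \<open>The norm can be read off the quadratic equation. Comparing the image of the equation of \<open>x\<close> with the
equation of \<open>B x\<close> forces the norms to agree, unless \<open>B x\<close> is a multiple of \<open>e\<close>; but then so is \<open>x\<close>,
and \<open>B\<close> fixes \<open>x\<close>.\<close>

lemma okubo_dot_automorphism_orthogonal:
  assumes B: "okubo_dot_automorphism B" shows "orthogonal_transformation B"
proof -
  have l: "linear B" and inj: "inj B" and mult: "B (x \<odot> y) = B x \<odot> B y" for x y
    using B by (auto simp: okubo_dot_automorphism_def bij_is_inj)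
  have Be: "B okubo_e = okubo_e" using B by (rule okubo_dot_automorphism_unit)
  have "B x \<bullet> B x = x \<bullet> x" for x
  proof -
    have eq: "(2 * (B x \<bullet> okubo_e - x \<bullet> okubo_e)) *\<^sub>R B x = (B x \<bullet> B x - x \<bullet> x) *\<^sub>R okubo_e"
      using mult[of x x] okubo_dot_square[of x] okubo_dot_square[of "B x"]
      by (simp add: linear_diff[OF l] linear_scale[OF l] Be algebra_simps)
    show ?thesis
    proof (cases "B x \<bullet> okubo_e = x \<bullet> okubo_e")
      case True
      with eq show ?thesis using inner_okubo_e by auto
    next
      case False
      define r where "r = (B x \<bullet> B x - x \<bullet> x) / (2 * (B x \<bullet> okubo_e - x \<bullet> okubo_e))"
      have "B x = r *\<^sub>R okubo_e"
        using eq False by (simp add: r_def eq_vector_fraction_iff)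
      then have "B x = B (r *\<^sub>R okubo_e)" by (simp add: linear_scale[OF l] Be)
      then have "x = r *\<^sub>R okubo_e" using inj by (simp add: inj_eq)
      with \<open>B x = r *\<^sub>R okubo_e\<close> show ?thesis by simp
    qed
  qed
  then show ?thesis using l by (simp add: orthogonal_transformation norm_eq_sqrt_inner)
qed

lemma okubo_basis_enumeration:
  obtains b :: "8 \<Rightarrow> okubo" where "bij_betw b UNIV Basis"
  using finite_same_card_bij[of "UNIV :: 8 set" "Basis :: okubo set"] DIM_okubo by auto

text \<open>If the determinant is \<open>-1\<close>, some unit vector \<open>u\<close> is mapped to \<open>- u\<close>; it is orthogonal to \<open>e\<close>. Left
multiplication by \<open>u\<close> is a complex structure for which \<open>B\<close> is antilinear, and so is left
multiplication by a unit vector \<open>w'\<close> orthogonal to \<open>u\<close> and \<open>e\<close>. Their composition is linear for this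
structure and has determinant 1. Left multiplication by \<open>w'\<close>, which commutes with itself, has
determinant 1 by the same criterion, so \<open>B\<close> has determinant 1 after all.\<close>

lemma okubo_dot_automorphism_lin_det:
  assumes B: "okubo_dot_automorphism B" shows "lin_det B = 1"
proof (rule ccontr)
  assume "lin_det B \<noteq> 1"
  obtain b :: "8 \<Rightarrow> okubo" where b: "bij_betw b UNIV Basis" by (rule okubo_basis_enumeration)
  have orth: "orthogonal_transformation B" using B by (rule okubo_dot_automorphism_orthogonal)
  then have l: "linear B" by (rule orthogonal_transformation_linear)
  have "lin_det B = - 1" using orthogonal_lin_det[OF b orth] \<open>lin_det B \<noteq> 1\<close> by simp
  then obtain u where u: "norm u = 1" "B u = - u"
    using orthogonal_lin_det_minus_1_imp_eigenvector[OF b orth] by blast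
  have uu: "u \<bullet> u = 1" using u by (simp add: dot_square_norm)
  have "B u \<bullet> B okubo_e = u \<bullet> okubo_e" using orth by (simp add: orthogonal_transformation_def)
  then have ue: "u \<bullet> okubo_e = 0" by (simp add: okubo_dot_automorphism_unit[OF B] u)
  have "dim {u, okubo_e} \<le> card {u, okubo_e}" by (intro dim_le_card') simp
  also have "\<dots> < DIM(okubo)"
    by (rule le_less_trans[OF card_insert_le_m1[of 2]]) (simp_all add: DIM_okubo)
  finally obtain w where w: "w \<noteq> 0" "\<And>y. y \<in> span {u, okubo_e} \<Longrightarrow> orthogonal w y"
    using orthogonal_to_subspace_exists by blast
  define w' where "w' = w /\<^sub>R norm w"
  have w': "w' \<bullet> w' = 1" "u \<bullet> w' = 0" "w' \<bullet> okubo_e = 0"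
    using w(1) w(2)[of u] w(2)[of okubo_e]
    by (simp_all add: w'_def orthogonal_def span_base inner_commute[of u w] dot_square_norm
        power2_eq_square)
  note U = okubo_dot_orthogonal[OF uu] and W = okubo_dot_orthogonal[OF w'(1)]
  have anti: "u \<odot> (w' \<odot> x) = - (w' \<odot> (u \<odot> x))" for x
    by (rule okubo_dot_anticommute[OF ue w'(3,2)])
  have mult: "B (x \<odot> y) = B x \<odot> B y" for x y
    using B by (simp add: okubo_dot_automorphism_def)
  have "lin_det (B \<circ> (\<odot>) w') = 1"
  proof (rule orthogonal_commuting_with_complex_structure_lin_det[OF b U])
    show "orthogonal_transformation (B \<circ> (\<odot>) w')"
      using orth W by (rule orthogonal_transformation_compose)
    show "(B \<circ> (\<odot>) w') (u \<odot> x) = u \<odot> (B \<circ> (\<odot>) w') x" for x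
    proof -
      have "w' \<odot> (u \<odot> x) = - (u \<odot> (w' \<odot> x))" using anti[of x] by simp
      then show ?thesis by (simp add: mult[of u] linear_neg[OF l] u okubo_dot_linear)
    qed
  qed (simp add: okubo_dot_alternative[OF ue] uu)
  moreover have "lin_det ((\<odot>) w') = 1"
    by (rule orthogonal_commuting_with_complex_structure_lin_det[OF b W])
      (simp_all add: W okubo_dot_alternative[OF w'(3)] w'(1))
  ultimately have "lin_det B = 1"
    using lin_det_compose[OF b l orthogonal_transformation_linear[OF W]] by simp
  with \<open>lin_det B \<noteq> 1\<close> show False by simp
qed

section \<open>The octonion product in coordinates\<close>

lemma okubo_coords_add:
  "okubo_coords a b u v w + okubo_coords a' b' u' v' w'
     = okubo_coords (a + a') (b + b') (u + u') (v + v') (w + w')"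
  by (simp add: okubo_coords.rep_eq plus_okubo.rep_eq vec_eq_iff forall_3 complex_eq_iff
      algebra_simps flip: Rep_okubo_inject)

lemma okubo_coords_scaleR:
  "r *\<^sub>R okubo_coords a b u v w
     = okubo_coords (r * a) (r * b) (r *\<^sub>R u) (r *\<^sub>R v) (r *\<^sub>R w)"
  by (simp add: okubo_coords.rep_eq scaleR_okubo.rep_eq vec_eq_iff forall_3 complex_eq_iff
      algebra_simps flip: Rep_okubo_inject)

text \<open>These are the roots of unity \<open>3 \<mu> - 1\<close> and \<open>\<surd>3 \<mu>\<close>, of order 6 and 12; the first is the square of
the second.\<close>

definition okubo_omega :: complex where "okubo_omega = (1 + \<i> * sqrt 3) / 2"
definition okubo_zeta :: complex where "okubo_zeta = (sqrt 3 + \<i>) / 2"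

lemma sqrt3_simp: "sqrt 3 * (sqrt 3 * x) = 3 * x"
  by (simp flip: mult.assoc)

lemma okubo_mult_coords:
  "okubo_coords a b u v w \<star> okubo_coords a' b' u' v' w' = okubo_coords
    (a * a' - b * b' - w \<bullet> w' + Re (okubo_omega * (u * cnj u' + v * cnj v')))
    (Re (okubo_zeta * (cnj u * u' - cnj v * v')) + Im (cnj w * w') - a * b' - a' * b)
    (okubo_omega * (a * u') + cnj okubo_omega * (a' * u)
      + okubo_zeta * (b' * u + v * cnj w') + cnj okubo_zeta * (b * u' + v' * cnj w))
    (okubo_omega * (a * v') + cnj okubo_omega * (a' * v)
      + okubo_zeta * (u * w' - b' * v) + cnj okubo_zeta * (u' * w - b * v'))
    (okubo_zeta * (cnj u * v') + cnj okubo_zeta * (cnj u' * v)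
      + \<i> * (b * w' - b' * w) - a * w' - a' * w)"
  by (simp add: okubo_mult.rep_eq okubo_coords.rep_eq vec_eq_iff forall_3 cscale_def
      matrix_matrix_mult_def sum_3 mat_def trace3 okubo_mu_def okubo_omega_def okubo_zeta_def
      complex_eq_iff inner_complex_def field_simps sqrt3_simp flip: Rep_okubo_inject)

text \<open>The matrices commuting with \<open>e\<close> have coordinates \<open>a\<close>, \<open>b\<close>, \<open>w\<close> and form a quaternion subalgebra
for \<open>\<odot>\<close>, with basis \<open>e\<close>, \<open>i\<close> (from \<open>b\<close>), \<open>j\<close> and \<open>i \<odot> j\<close> (from \<open>w\<close>). The coordinates \<open>u\<close>, \<open>v\<close>
span its orthogonal complement, in which \<open>u = 1\<close> is taken as the doubling unit \<open>l\<close>; then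
\<open>j \<odot> l\<close> has \<open>v = \<i>\<close>, which accounts for the factor of \<open>\<delta>\<close>.\<close>

definition okubo_of_octonion :: "octonion \<Rightarrow> okubo" where
  "okubo_of_octonion = (\<lambda>((\<alpha>, \<beta>), (\<gamma>, \<delta>)). okubo_coords (Re \<alpha>) (Im \<alpha>) \<gamma> (\<i> * \<delta>) \<beta>)"

lemma okubo_e_mult_coords:
  "okubo_e \<star> okubo_coords a b u v w
     = okubo_coords a (- b) (okubo_omega * u) (okubo_omega * v) (- w)"
  "okubo_coords a b u v w \<star> okubo_e
     = okubo_coords a (- b) (cnj okubo_omega * u) (cnj okubo_omega * v) (- w)"
  by (simp_all add: okubo_e_coords okubo_mult_coords)

lemma okubo_dot_coords:
  "okubo_coords a b u v w \<odot> okubo_coords a' b' u' v' w' = okubo_coords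
    (a * a' - b * b' - w \<bullet> w' - u \<bullet> u' - v \<bullet> v')
    (a * b' + a' * b + Im (cnj u * u' - cnj v * v') + Im (cnj w * w'))
    (a * u' + a' * u - \<i> * (b' * u + v * cnj w') + \<i> * (b * u' + v' * cnj w))
    (a * v' + a' * v + \<i> * (b' * v - u * w') - \<i> * (b * v' - u' * w))
    (a * w' + a' * w - \<i> * (cnj u * v') + \<i> * (cnj u' * v) + \<i> * (b * w' - b' * w))"
  by (simp add: okubo_dot_def okubo_e_mult_coords okubo_mult_coords okubo_coords_inject
      okubo_omega_def okubo_zeta_def complex_eq_iff inner_complex_def field_simps sqrt3_simp)

lemma okubo_of_octonion_mult:
  "okubo_of_octonion (oct_mult x y) = okubo_of_octonion x \<odot> okubo_of_octonion y"
proof -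
  obtain \<alpha> \<beta> \<gamma> \<delta> where x: "x = ((\<alpha>, \<beta>), (\<gamma>, \<delta>))" by (metis prod.collapse)
  obtain \<alpha>' \<beta>' \<gamma>' \<delta>' where y: "y = ((\<alpha>', \<beta>'), (\<gamma>', \<delta>'))" by (metis prod.collapse)
  show ?thesis
    unfolding x y
    by (simp add: okubo_of_octonion_def okubo_dot_coords okubo_coords_inject complex_eq_iff
        inner_complex_def algebra_simps)
qed

lemma linear_okubo_of_octonion: "linear okubo_of_octonion"
  by (rule linearI)
    (auto simp: okubo_of_octonion_def okubo_coords_add okubo_coords_scaleR algebra_simps
      split: prod.splits)

lemma bij_okubo_of_octonion: "bij okubo_of_octonion"
proof (rule bijI)
  show "inj okubo_of_octonion"
    by (auto simp: inj_def okubo_of_octonion_def okubo_coords_inject complex_eq_iff)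
  have "\<exists>x. okubo_of_octonion x = y" for y
  proof (rule okubo_coords_cases[of y])
    fix a b u v w assume "y = okubo_coords a b u v w"
    then show ?thesis
      by (intro exI[of _ "((Complex a b, w), (u, - \<i> * v))"]) (simp add: okubo_of_octonion_def)
  qed
  then show "surj okubo_of_octonion" by (metis surjI)
qed

lift_definition octonion_iso :: "octonion \<Rightarrow>\<^sub>L okubo" is okubo_of_octonion
  using linear_okubo_of_octonion by (simp add: linear_conv_bounded_linear)

lift_definition octonion_iso_inv :: "okubo \<Rightarrow>\<^sub>L octonion" is "inv_into UNIV okubo_of_octonion"
proof -
  have "linear (inv_into UNIV okubo_of_octonion)"
  proof (rule linearI)
    note [simp] = bij_is_surj[OF bij_okubo_of_octonion, THEN surj_f_inv_f]
      bij_is_inj[OF bij_okubo_of_octonion, THEN inv_f_f]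
    have eqI: "inv_into UNIV okubo_of_octonion z = t" if "z = okubo_of_octonion t" for z t
      using that by simp
    show "inv_into UNIV okubo_of_octonion (x + y)
        = inv_into UNIV okubo_of_octonion x + inv_into UNIV okubo_of_octonion y" for x y
      by (rule eqI) (simp add: linear_add[OF linear_okubo_of_octonion])
    show "inv_into UNIV okubo_of_octonion (r *\<^sub>R x)
        = r *\<^sub>R inv_into UNIV okubo_of_octonion x" for r x
      by (rule eqI) (simp add: linear_scale[OF linear_okubo_of_octonion])
  qed
  then show "bounded_linear (inv_into UNIV okubo_of_octonion)" by (simp add: linear_conv_bounded_linear)
qed

lemma octonion_iso_inverse [simp]:
  "octonion_iso (octonion_iso_inv x) = x" "octonion_iso_inv (octonion_iso y) = y"
  by (transfer; simp add: bij_okubo_of_octonion bij_is_surj surj_f_inv_f bij_is_inj)+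

lemma bij_octonion_iso: "bij (blinfun_apply octonion_iso)" "bij (blinfun_apply octonion_iso_inv)"
  by (simp_all add: octonion_iso.rep_eq octonion_iso_inv.rep_eq bij_okubo_of_octonion bij_imp_bij_inv)

lemma octonion_iso_mult:
  "octonion_iso (oct_mult x y) = octonion_iso x \<odot> octonion_iso y"
  "octonion_iso_inv (s \<odot> t) = oct_mult (octonion_iso_inv s) (octonion_iso_inv t)"
proof -
  show *: "octonion_iso (oct_mult x y) = octonion_iso x \<odot> octonion_iso y" for x y
    by (simp add: octonion_iso.rep_eq okubo_of_octonion_mult)
  show "octonion_iso_inv (s \<odot> t) = oct_mult (octonion_iso_inv s) (octonion_iso_inv t)"
    using *[of "octonion_iso_inv s" "octonion_iso_inv t"] by (metis octonion_iso_inverse)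
qed

section \<open>Related triples fixing the idempotent\<close>

lift_definition okubo_left_e :: "okubo \<Rightarrow>\<^sub>L okubo" is "\<lambda>x. okubo_e \<star> x"
  using bilinear_okubo_mult by (simp add: bilinear_def linear_conv_bounded_linear)

lift_definition okubo_right_e :: "okubo \<Rightarrow>\<^sub>L okubo" is "\<lambda>x. x \<star> okubo_e"
  using bilinear_okubo_mult by (simp add: bilinear_def linear_conv_bounded_linear)

text \<open>The triples fixing \<open>e\<close> are determined by their middle component \<open>B\<close>, because \<open>A\<close> and \<open>C\<close> can be
recovered from \<open>B (e \<star> x) = e \<star> A x\<close> and \<open>B (x \<star> e) = C x \<star> e\<close>.\<close>

definition triality_lift :: "(okubo \<Rightarrow>\<^sub>L okubo)
    \<Rightarrow> (okubo \<Rightarrow>\<^sub>L okubo) \<times> (okubo \<Rightarrow>\<^sub>L okubo) \<times> (okubo \<Rightarrow>\<^sub>L okubo)" where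
  "triality_lift B = (okubo_right_e o\<^sub>L B o\<^sub>L okubo_left_e, B, okubo_left_e o\<^sub>L B o\<^sub>L okubo_right_e)"

lemma triality_lift_compose:
  "triality_lift (X o\<^sub>L Y) = triality_lift X \<otimes>\<^bsub>okubo_Tri_group\<lparr>carrier := S\<rparr>\<^esub> triality_lift Y"
  by (auto intro!: blinfun_eqI simp: okubo_Tri_group_def triality_lift_def okubo_right_e.rep_eq
      okubo_left_e.rep_eq okubo_e_cancel)

lemma okubo_SO_iff:
  "A \<in> okubo_SO \<longleftrightarrow> orthogonal_transformation (blinfun_apply A) \<and> lin_det (blinfun_apply A) = 1"
  by (auto simp: okubo_SO_def okubo_norm_eq orthogonal_transformation norm_eq_sqrt_inner
      bounded_linear.linear[OF blinfun.bounded_linear_right])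

text \<open>As left and right multiplication by \<open>e\<close> are inverse to each other, these compositions are conjugates of
\<open>B\<close> and have the same determinant.\<close>

lemma okubo_SO_conjugate:
  assumes "B \<in> okubo_SO"
  shows "okubo_right_e o\<^sub>L B o\<^sub>L okubo_left_e \<in> okubo_SO"
    and "okubo_left_e o\<^sub>L B o\<^sub>L okubo_right_e \<in> okubo_SO"
proof -
  obtain b :: "8 \<Rightarrow> okubo" where b: "bij_betw b UNIV Basis" by (rule okubo_basis_enumeration)
  have lin: "linear (blinfun_apply A)" for A :: "okubo \<Rightarrow>\<^sub>L okubo"
    by (rule bounded_linear.linear[OF blinfun.bounded_linear_right])
  have det: "lin_det (blinfun_apply (X o\<^sub>L Y)) = lin_det (blinfun_apply X) * lin_det (blinfun_apply Y)"
    for X Y :: "okubo \<Rightarrow>\<^sub>L okubo"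
    using lin_det_compose[OF b lin lin, of X Y] by (simp add: blinfun_compose.rep_eq comp_def)
  have "blinfun_apply (okubo_right_e o\<^sub>L okubo_left_e) = id"
    by (simp add: fun_eq_iff okubo_right_e.rep_eq okubo_left_e.rep_eq okubo_e_cancel)
  then have "lin_det (blinfun_apply okubo_right_e) * lin_det (blinfun_apply okubo_left_e) = 1"
    using det[of okubo_right_e okubo_left_e] lin_det_id[OF b] by simp
  with assms
  show "okubo_right_e o\<^sub>L B o\<^sub>L okubo_left_e \<in> okubo_SO"
    "okubo_left_e o\<^sub>L B o\<^sub>L okubo_right_e \<in> okubo_SO"
    by (simp_all add: okubo_SO_def det mult.commute okubo_norm_eq okubo_norm_mult inner_okubo_e
        okubo_right_e.rep_eq okubo_left_e.rep_eq)
qed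

abbreviation okubo_Tri_fixing_e where
  "okubo_Tri_fixing_e \<equiv> {(A, B, C). (A, B, C) \<in> okubo_Tri \<and>
     blinfun_apply A okubo_e = okubo_e \<and> blinfun_apply B okubo_e = okubo_e \<and>
     blinfun_apply C okubo_e = okubo_e}"

text \<open>Every Okubo product is an octonion product, \<open>s \<star> x = (s \<star> e) \<odot> (e \<star> x)\<close>, so multiplicativity of
\<open>B\<close> for \<open>\<odot>\<close> is the triality relation of its lift.\<close>

lemma triality_lift_in_Tri:
  assumes B: "okubo_dot_automorphism (blinfun_apply B)"
  shows "triality_lift B \<in> okubo_Tri_fixing_e"
proof -
  have SO: "B \<in> okubo_SO"
    by (simp add: okubo_SO_iff okubo_dot_automorphism_orthogonal[OF B]
        okubo_dot_automorphism_lin_det[OF B])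
  have split: "B (s \<star> x) = (okubo_e \<star> B (s \<star> okubo_e)) \<star> (B (okubo_e \<star> x) \<star> okubo_e)" for s x
  proof -
    have "s \<star> x = (s \<star> okubo_e) \<odot> (okubo_e \<star> x)"
      by (simp add: okubo_dot_def okubo_e_cancel)
    then have "B (s \<star> x) = B (s \<star> okubo_e) \<odot> B (okubo_e \<star> x)"
      using B by (simp add: okubo_dot_automorphism_def)
    then show ?thesis by (simp add: okubo_dot_def)
  qed
  show ?thesis
    using okubo_SO_conjugate[OF SO]
    by (simp add: SO triality_lift_def okubo_Tri_def okubo_right_e.rep_eq okubo_left_e.rep_eq
        okubo_e_idempotent okubo_dot_automorphism_unit[OF B])
      (intro allI split)
qed

lemma Tri_fixing_e_imp_automorphism:
  assumes "(A, B, C) \<in> okubo_Tri_fixing_e"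
  shows "okubo_dot_automorphism (blinfun_apply B)" "triality_lift B = (A, B, C)"
proof -
  have SO: "B \<in> okubo_SO" and tri: "B (s \<star> x) = C s \<star> A x"
    and e: "A okubo_e = okubo_e" "B okubo_e = okubo_e" "C okubo_e = okubo_e" for s x
    using assms by (auto simp: okubo_Tri_def)
  have A: "A x = B (okubo_e \<star> x) \<star> okubo_e" and C: "C x = okubo_e \<star> B (x \<star> okubo_e)" for x
    by (simp_all add: tri e okubo_e_cancel)
  then show "triality_lift B = (A, B, C)"
    by (auto intro!: blinfun_eqI simp: triality_lift_def okubo_right_e.rep_eq okubo_left_e.rep_eq)
  have "B (x \<odot> y) = B x \<odot> B y" for x y
    unfolding okubo_dot_def tri by (simp add: A C okubo_e_cancel)
  moreover have "orthogonal_transformation (blinfun_apply B)" using SO by (simp add: okubo_SO_iff)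
  ultimately show "okubo_dot_automorphism (blinfun_apply B)"
    by (simp add: okubo_dot_automorphism_def orthogonal_transformation_linear
        orthogonal_transformation_bij)
qed

text \<open>Combined with the triality relation, the two conditions on the right say that \<open>C e\<close> and \<open>e\<close>
have the same product with every \<open>A x\<close>, and that \<open>A e\<close> and \<open>e\<close> have the same product with every
\<open>C x\<close>. By surjectivity \<open>x\<close> can be chosen with \<open>A x = e\<close> or \<open>C x = e\<close>, and \<open>e\<close> can be cancelled.\<close>

lemma Tri_fixing_e_iff:
  assumes "(A, B, C) \<in> okubo_Tri"
  shows "A okubo_e = okubo_e \<and> B okubo_e = okubo_e \<and> C okubo_e = okubo_e \<longleftrightarrow>
    (\<forall>x. B (okubo_e \<star> x) = okubo_e \<star> A x \<and> B (x \<star> okubo_e) = C x \<star> okubo_e)"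
proof -
  have tri: "B (s \<star> x) = C s \<star> A x" for s x
    using assms by (simp add: okubo_Tri_def)
  have surj: "surj (blinfun_apply A)" "surj (blinfun_apply C)"
    using assms by (auto simp: okubo_Tri_def okubo_SO_iff orthogonal_transformation_surj)
  show ?thesis
  proof
    assume R: "\<forall>x. B (okubo_e \<star> x) = okubo_e \<star> A x \<and> B (x \<star> okubo_e) = C x \<star> okubo_e"
    have "C okubo_e = okubo_e"
    proof -
      obtain x where "A x = okubo_e" using surj by (metis surjD)
      then have "C okubo_e \<star> okubo_e = okubo_e" using R tri okubo_e_idempotent by metis
      then show ?thesis using okubo_e_cancel(1) okubo_e_idempotent by metis
    qed
    moreover have "A okubo_e = okubo_e"
    proof -
      obtain x where "C x = okubo_e" using surj by (metis surjD)
      then have "okubo_e \<star> A okubo_e = okubo_e" using R tri okubo_e_idempotent by metis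
      then show ?thesis using okubo_e_cancel(2) okubo_e_idempotent by metis
    qed
    ultimately show "A okubo_e = okubo_e \<and> B okubo_e = okubo_e \<and> C okubo_e = okubo_e"
      using tri okubo_e_idempotent by metis
  qed (simp add: tri)
qed

section \<open>The isomorphism of Lie groups\<close>

lemma Ck_on_const: "Ck_on k (\<lambda>x. c) U"
  by (induction k arbitrary: c) (simp_all add: frechet_derivative_const)

lemma Ck_on_bounded_linear:
  assumes "bounded_linear f" shows "Ck_on k f U"
proof (cases k)
  case 0
  with assms show ?thesis by (simp add: linear_continuous_on)
next
  case (Suc n)
  have d: "(f has_derivative f) (at x)" for x
    using assms by (rule bounded_linear_imp_has_derivative)
  then have "frechet_derivative f (at x) = f" for x
    by (metis frechet_derivative_at)
  with d Suc show ?thesis by (auto simp: differentiable_def Ck_on_const)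
qed

lemma smooth_map_on_bounded_linear:
  assumes "bounded_linear F" "\<And>y. y \<in> S \<Longrightarrow> F y = f y"
  shows "smooth_map_on S f"
  unfolding smooth_map_on_def
proof
  fix x assume "x \<in> S"
  with assms show "\<exists>U F. open U \<and> x \<in> U \<and> (\<forall>k. Ck_on k F U) \<and> (\<forall>y\<in>S \<inter> U. F y = f y)"
    by (intro exI[of _ UNIV] exI[of _ F]) (auto intro: Ck_on_bounded_linear)
qed

text \<open>Smoothness is automatic when both directions are restrictions of linear maps defined on the
whole spaces of endomorphisms.\<close>

lemma lie_isomorphic_by_bounded_linear:
  assumes F: "bounded_linear F" and K: "bounded_linear K"
    and hom: "F \<in> hom G H" and K_carrier: "\<And>y. y \<in> carrier H \<Longrightarrow> K y \<in> carrier G"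
    and KF: "\<And>x. x \<in> carrier G \<Longrightarrow> K (F x) = x" and FK: "\<And>y. y \<in> carrier H \<Longrightarrow> F (K y) = y"
  shows "G \<cong>\<^sub>L H"
  unfolding lie_isomorphic_def
proof (intro bexI conjI)
  have F_carrier: "F x \<in> carrier H" if "x \<in> carrier G" for x
    using hom that by (auto simp: hom_def)
  have bij: "bij_betw F (carrier G) (carrier H)"
    by (rule bij_betw_byWitness[where f' = K]) (auto simp: KF FK F_carrier K_carrier)
  with hom show "F \<in> Group.iso G H" by (simp add: iso_def)
  show "smooth_map_on (carrier G) F"
    using F by (rule smooth_map_on_bounded_linear) simp
  show "smooth_map_on (carrier H) (inv_into (carrier G) F)"
    using K
  proof (rule smooth_map_on_bounded_linear)
    fix y assume y: "y \<in> carrier H"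
    have "inv_into (carrier G) F (F (K y)) = K y"
      using bij y by (intro inv_into_f_f) (auto simp: bij_betw_def K_carrier)
    with y show "K y = inv_into (carrier G) F y" by (simp add: FK)
  qed
qed

lemma bounded_linear_sandwich: "bounded_linear (\<lambda>X. P o\<^sub>L X o\<^sub>L Q)"
  using bounded_linear_compose[OF
    bounded_bilinear.bounded_linear_left[OF bounded_bilinear_blinfun_compose, of Q]
    bounded_bilinear.bounded_linear_right[OF bounded_bilinear_blinfun_compose, of P]] .

lemma bij_sandwich:
  assumes "bij (blinfun_apply P)" "bij (blinfun_apply X)" "bij (blinfun_apply Q)"
  shows "bij (blinfun_apply (P o\<^sub>L X o\<^sub>L Q))"
proof -
  have "blinfun_apply (P o\<^sub>L X o\<^sub>L Q) = blinfun_apply P \<circ> (blinfun_apply X \<circ> blinfun_apply Q)"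
    by (rule ext) simp
  with assms show ?thesis by (simp add: bij_comp)
qed

lemma G2_compact_iff:
  "A \<in> carrier G2_compact \<longleftrightarrow>
     bij (blinfun_apply A) \<and> (\<forall>x y. A (oct_mult x y) = oct_mult (A x) (A y))"
  unfolding G2_compact_def by simp

lemma carrier_okubo_Tri_subgroup: "carrier (okubo_Tri_group\<lparr>carrier := S\<rparr>) = S"
  by simp

lemma mult_G2_compact: "X \<otimes>\<^bsub>G2_compact\<^esub> Y = X o\<^sub>L Y"
  by (simp add: G2_compact_def)

text \<open>Transporting an octonion automorphism to the Okubo algebra and lifting it to a triple is linear in
the automorphism; so is the inverse, which picks the middle component and transports it back.\<close>

lemma G2_compact_isomorphic_Tri_fixing_e:
  "G2_compact \<cong>\<^sub>L okubo_Tri_group\<lparr>carrier := okubo_Tri_fixing_e\<rparr>"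
proof (rule lie_isomorphic_by_bounded_linear)
  let ?T = "\<lambda>\<beta>. octonion_iso o\<^sub>L \<beta> o\<^sub>L octonion_iso_inv"
  let ?F = "\<lambda>\<beta>. triality_lift (?T \<beta>)"
  let ?K = "\<lambda>t. octonion_iso_inv o\<^sub>L fst (snd t) o\<^sub>L octonion_iso"
  have lift: "bounded_linear triality_lift"
    unfolding triality_lift_def
    by (intro bounded_linear_Pair bounded_linear_sandwich bounded_linear_ident)
  show "bounded_linear ?F"
    using bounded_linear_compose[OF lift bounded_linear_sandwich] .
  show "bounded_linear ?K"
    by (rule bounded_linear_compose[OF bounded_linear_sandwich
        bounded_linear_compose[OF bounded_linear_fst bounded_linear_snd]])
  have F: "?F \<beta> \<in> okubo_Tri_fixing_e" if "\<beta> \<in> carrier G2_compact" for \<beta>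
  proof (rule triality_lift_in_Tri)
    have \<beta>: "bij (blinfun_apply \<beta>)" "\<beta> (oct_mult x y) = oct_mult (\<beta> x) (\<beta> y)" for x y
      using that by (simp_all only: G2_compact_iff)
    have "bij (blinfun_apply (?T \<beta>))"
      by (rule bij_sandwich) (rule bij_octonion_iso \<beta>(1))+
    moreover have "linear (blinfun_apply (?T \<beta>))"
      by (rule bounded_linear.linear[OF blinfun.bounded_linear_right])
    ultimately show "okubo_dot_automorphism (blinfun_apply (?T \<beta>))"
      by (simp add: okubo_dot_automorphism_def octonion_iso_mult \<beta>)
  qed
  show "?F \<in> hom G2_compact (okubo_Tri_group\<lparr>carrier := okubo_Tri_fixing_e\<rparr>)"
  proof (rule homI)
    fix \<beta> assume "\<beta> \<in> carrier G2_compact"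
    then show "?F \<beta> \<in> carrier (okubo_Tri_group\<lparr>carrier := okubo_Tri_fixing_e\<rparr>)"
      unfolding carrier_okubo_Tri_subgroup by (rule F)
  next
    fix \<beta> \<gamma>
    have T: "?T (\<beta> o\<^sub>L \<gamma>) = ?T \<beta> o\<^sub>L ?T \<gamma>"
      by (rule blinfun_eqI) simp
    show "?F (\<beta> \<otimes>\<^bsub>G2_compact\<^esub> \<gamma>)
        = ?F \<beta> \<otimes>\<^bsub>okubo_Tri_group\<lparr>carrier := okubo_Tri_fixing_e\<rparr>\<^esub> ?F \<gamma>"
      unfolding mult_G2_compact T by (rule triality_lift_compose)
  qed
  show "?K (?F \<beta>) = \<beta>" for \<beta>
    by (rule blinfun_eqI) (simp add: triality_lift_def)
  fix t assume "t \<in> carrier (okubo_Tri_group\<lparr>carrier := okubo_Tri_fixing_e\<rparr>)"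
  then obtain A B C where t: "t = (A, B, C)" "(A, B, C) \<in> okubo_Tri_fixing_e" by auto
  note B = Tri_fixing_e_imp_automorphism[OF t(2)]
  have "bij (blinfun_apply B)" "B (x \<odot> y) = B x \<odot> B y" for x y
    using B(1) by (auto simp: okubo_dot_automorphism_def)
  have "?T (?K t) = B"
    by (rule blinfun_eqI) (simp add: t)
  then show "?F (?K t) = t" using B(2) t by simp
  have "bij (blinfun_apply (?K t))"
    unfolding t fst_conv snd_conv
    by (rule bij_sandwich) (rule bij_octonion_iso \<open>bij (blinfun_apply B)\<close>)+
  with \<open>\<And>x y. B (x \<odot> y) = B x \<odot> B y\<close> show "?K t \<in> carrier G2_compact"
    by (simp only: G2_compact_iff blinfun_apply_blinfun_compose octonion_iso_mult t
        fst_conv snd_conv simp_thms)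
qed

theorem theorem29:
  "let S1 = {(A, B, C).
              (A, B, C) \<in> okubo_Tri \<and> (\<forall>s x. B (s \<star> x) = C s \<star> A x) \<and>
              A okubo_e = okubo_e \<and> B okubo_e = okubo_e \<and> C okubo_e = okubo_e};
       S2 = {(A, B, C).
              (A, B, C) \<in> okubo_Tri \<and>
              (\<forall>x. B (okubo_e \<star> x) = okubo_e \<star> A x \<and> B (x \<star> okubo_e) = C x \<star> okubo_e)}
   in G2_compact \<cong>\<^sub>L okubo_Tri_group\<lparr>carrier := S1\<rparr> \<and>
      G2_compact \<cong>\<^sub>L okubo_Tri_group\<lparr>carrier := S2\<rparr> \<and>
      S1 = S2"
proof -
  have "{(A, B, C). (A, B, C) \<in> okubo_Tri \<and> (\<forall>s x. B (s \<star> x) = C s \<star> A x) \<and>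
      A okubo_e = okubo_e \<and> B okubo_e = okubo_e \<and> C okubo_e = okubo_e} = okubo_Tri_fixing_e"
    by (auto simp: okubo_Tri_def)
  moreover have "{(A, B, C). (A, B, C) \<in> okubo_Tri \<and>
      (\<forall>x. B (okubo_e \<star> x) = okubo_e \<star> A x \<and> B (x \<star> okubo_e) = C x \<star> okubo_e)}
      = okubo_Tri_fixing_e"
    using Tri_fixing_e_iff by blast
  ultimately show ?thesis
    unfolding Let_def using G2_compact_isomorphic_Tri_fixing_e by simp
qed

end
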